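(* Let $m_1,m_2,m_3>0$ and let $L\in\bigwedge^2\mathbb{R}^4$ be a bivector of rank 4. Let $M_L$ be the set of states of the Newtonian 3-body problem in $\mathbb{R}^4$ with masses $m_1,m_2,m_3$ and angular momentum $L$, and let $H_{\inf}=\inf_{M_L}H$ be the infimum of the energy on $M_L$. If $(s_n)$ is a sequence in $M_L$ such that $H(s_n)\to H_{\inf}$, then the sequence $(s_n)$ is bounded.
   Context: Let $E=\mathbb{R}^4$ with its Euclidean structure. Bodies with positions $q_1,q_2,q_3\in E$ and masses $m_1,m_2,m_3>0$ have their center of mass fixed at the origin. Put $q=q_2-q_1$, $Q=q_3-(m_1q_1+m_2q_2)/(m_1+m_2)$ (Jacobi vectors), $\mu=\frac{m_1m_2}{m_1+m_2}$, $\nu=\frac{m_3(m_1+m_2)}{m_1+m_2+m_3}$, $p=\mu\dot q$, $P=\nu\dot Q$. A state is a quadruple $(q,p,Q,P)\in E^4$ for which the three bodies have pairwise distinct positions; boundedness of a sequence of states means boundedness in $E^4\cong\mathbb{R}^{16}$. The mutual distances $d_{ij}=|q_i-q_j|$ are $d_{12}=|q|$, $d_{13}=|Q+\frac{m_2}{m_1+m_2}q|$, $d_{23}=|Q-\frac{m_1}{m_1+m_2}q|$. The energy is $H=T+V$ with $T=\frac{|p|^2}{2\mu}+\frac{|P|^2}{2\nu}$ and $V=-\frac{m_1m_2}{d_{12}}-\frac{m_2m_3}{d_{23}}-\frac{m_1m_3}{d_{13}}$. The angular momentum is the bivector $q\wedge p+Q\wedge P\in\bigwedge^2E$. Bivectors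 are identified with antisymmetric $4\times4$ matrices, and the rank of a bivector is the rank of this matrix. For rank 4 angular momentum $L$, $H$ is known to be bounded below on $M_L$, so $H_{\inf}$ is finite. *)

theory Defs
  imports "HOL-Analysis.Analysis"
begin

type_synonym vec4 = "real ^ 4"

text \<open>A state is a quadruple \<open>(q, p, Q, P)\<close> of Jacobi vectors and their momenta.\<close>

type_synonym state = "vec4 \<times> vec4 \<times> vec4 \<times> vec4"

text \<open>The masses occur as explicit parameters; all definitions are meant for positive masses.
  The functions \<open>pos1\<close>, \<open>pos2\<close>, \<open>pos3\<close> invert the Jacobi coordinates: they give
  the unique configuration with center of mass at the origin that has Jacobi vectors
  \<open>q\<close>, \<open>Q\<close>; see the lemma \<open>jacobi_iff\<close>.\<close>

definition pos1 :: "real \<Rightarrow> real \<Rightarrow> real \<Rightarrow> vec4 \<Rightarrow> vec4 \<Rightarrow> vec4" where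
  "pos1 m1 m2 m3 q Q = - (m3 / (m1 + m2 + m3)) *\<^sub>R Q - (m2 / (m1 + m2)) *\<^sub>R q"

definition pos2 :: "real \<Rightarrow> real \<Rightarrow> real \<Rightarrow> vec4 \<Rightarrow> vec4 \<Rightarrow> vec4" where
  "pos2 m1 m2 m3 q Q = - (m3 / (m1 + m2 + m3)) *\<^sub>R Q + (m1 / (m1 + m2)) *\<^sub>R q"

definition pos3 :: "real \<Rightarrow> real \<Rightarrow> real \<Rightarrow> vec4 \<Rightarrow> vec4 \<Rightarrow> vec4" where
  "pos3 m1 m2 m3 q Q = ((m1 + m2) / (m1 + m2 + m3)) *\<^sub>R Q"

definition states :: "real \<Rightarrow> real \<Rightarrow> real \<Rightarrow> state set" where
  "states m1 m2 m3 = {(q, p, Q, P).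
     pos1 m1 m2 m3 q Q \<noteq> pos2 m1 m2 m3 q Q \<and>
     pos2 m1 m2 m3 q Q \<noteq> pos3 m1 m2 m3 q Q \<and>
     pos1 m1 m2 m3 q Q \<noteq> pos3 m1 m2 m3 q Q}"

definition kinetic :: "real \<Rightarrow> real \<Rightarrow> real \<Rightarrow> state \<Rightarrow> real" where
  "kinetic m1 m2 m3 = (\<lambda>(q, p, Q, P).
     let \<mu> = m1 * m2 / (m1 + m2); \<nu> = m3 * (m1 + m2) / (m1 + m2 + m3)
     in (norm p)\<^sup>2 / (2 * \<mu>) + (norm P)\<^sup>2 / (2 * \<nu>))"

definition potential :: "real \<Rightarrow> real \<Rightarrow> real \<Rightarrow> state \<Rightarrow> real" where
  "potential m1 m2 m3 = (\<lambda>(q, p, Q, P).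
     - m1 * m2 / dist (pos1 m1 m2 m3 q Q) (pos2 m1 m2 m3 q Q)
     - m2 * m3 / dist (pos2 m1 m2 m3 q Q) (pos3 m1 m2 m3 q Q)
     - m1 * m3 / dist (pos1 m1 m2 m3 q Q) (pos3 m1 m2 m3 q Q))"

definition energy :: "real \<Rightarrow> real \<Rightarrow> real \<Rightarrow> state \<Rightarrow> real" where
  "energy m1 m2 m3 s = kinetic m1 m2 m3 s + potential m1 m2 m3 s"

text \<open>Bivectors are antisymmetric matrices, so that the rank of a bivector is the library's
  matrix \<^const>\<open>rank\<close>.\<close>

definition bivector :: "real ^ 4 ^ 4 \<Rightarrow> bool" where
  "bivector L \<longleftrightarrow> transpose L = - L"

definition wedge :: "vec4 \<Rightarrow> vec4 \<Rightarrow> real ^ 4 ^ 4" where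
  "wedge u v = (\<chi> i j. u $ i * v $ j - v $ i * u $ j)"

definition angular_momentum :: "state \<Rightarrow> real ^ 4 ^ 4" where
  "angular_momentum = (\<lambda>(q, p, Q, P). wedge q p + wedge Q P)"

definition level_set :: "real \<Rightarrow> real \<Rightarrow> real \<Rightarrow> real ^ 4 ^ 4 \<Rightarrow> state set" where
  "level_set m1 m2 m3 L = {s \<in> states m1 m2 m3. angular_momentum s = L}"

text \<open>The infimum is taken in the extended reals: on \<^typ>\<open>real\<close>, \<^const>\<open>Inf\<close> of a set
  that is not bounded below would be meaningless, and boundedness from below is a theorem for
  \<open>L\<close> of rank 4, not part of the definition.\<close>

definition H_inf :: "real \<Rightarrow> real \<Rightarrow> real \<Rightarrow> real ^ 4 ^ 4 \<Rightarrow> ereal" where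
  "H_inf m1 m2 m3 L = (INF s \<in> level_set m1 m2 m3 L. ereal (energy m1 m2 m3 s))"

lemma bivector_wedge: "bivector (wedge u v)"
  by (simp add: bivector_def wedge_def transpose_def vec_eq_iff)

lemma jacobi_iff:
  fixes q1 q2 q3 q Q :: vec4
  assumes "m1 > 0" "m2 > 0" "m3 > 0"
  shows "q1 = pos1 m1 m2 m3 q Q \<and> q2 = pos2 m1 m2 m3 q Q \<and> q3 = pos3 m1 m2 m3 q Q \<longleftrightarrow>
    m1 *\<^sub>R q1 + m2 *\<^sub>R q2 + m3 *\<^sub>R q3 = 0 \<and> q = q2 - q1 \<and>
    Q = q3 - (1 / (m1 + m2)) *\<^sub>R (m1 *\<^sub>R q1 + m2 *\<^sub>R q2)"
proof -
  have nz: "m1 + m2 \<noteq> 0" "m1 + m2 + m3 \<noteq> 0"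
    using assms by auto
  have scalar: "a = - (m3 / (m1 + m2 + m3)) * y - (m2 / (m1 + m2)) * x \<and>
      b = - (m3 / (m1 + m2 + m3)) * y + (m1 / (m1 + m2)) * x \<and>
      c = ((m1 + m2) / (m1 + m2 + m3)) * y \<longleftrightarrow>
      m1 * a + m2 * b + m3 * c = 0 \<and> x = b - a \<and>
      y = c - (1 / (m1 + m2)) * (m1 * a + m2 * b)" (is "?l \<longleftrightarrow> ?r") for a b c x y :: real
  proof
    assume ?l
    with nz show ?r
      by (simp add: divide_simps) algebra
  next
    assume r: ?r
    define B where "B = (1 / (m1 + m2)) * (m1 * a + m2 * b)"
    have mB: "(m1 + m2) * B = m1 * a + m2 * b"
      using nz by (simp add: B_def)
    have y: "y = c - B" and x: "x = b - a"
      using r by (simp_all add: B_def)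
    have z: "(m1 + m2) * B + m3 * c = 0"
      using r mB by simp
    have Meq: "(m1 + m2 + m3) * B = - (m3 * y)" "(m1 + m2 + m3) * c = (m1 + m2) * y"
      using y z by algebra+
    have B: "B = - (m3 / (m1 + m2 + m3)) * y" and c: "c = ((m1 + m2) / (m1 + m2 + m3)) * y"
      using Meq nz by (simp_all add: field_simps)
    have eq: "(m1 + m2) * a = (m1 + m2) * B - m2 * x" "(m1 + m2) * b = (m1 + m2) * B + m1 * x"
      using x mB by algebra+
    have "a = B - (m2 / (m1 + m2)) * x" "b = B + (m1 / (m1 + m2)) * x"
      using eq nz by (simp_all add: field_simps)
    with B c show ?l by simp
  qed
  show ?thesis
    using scalar by (simp add: pos1_def pos2_def pos3_def vec_eq_iff) blast
qed

lemma dist_pos: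
  assumes "m1 > 0" "m2 > 0" "m3 > 0"
  shows "dist (pos1 m1 m2 m3 q Q) (pos2 m1 m2 m3 q Q) = norm q"
    and "dist (pos1 m1 m2 m3 q Q) (pos3 m1 m2 m3 q Q) = norm (Q + (m2 / (m1 + m2)) *\<^sub>R q)"
    and "dist (pos2 m1 m2 m3 q Q) (pos3 m1 m2 m3 q Q) = norm (Q - (m1 / (m1 + m2)) *\<^sub>R q)"
proof -
  have nz: "m1 + m2 \<noteq> 0" "m1 + m2 + m3 \<noteq> 0"
    using assms by auto
  have M: "m3 / (m1 + m2 + m3) + (m1 + m2) / (m1 + m2 + m3) = 1"
    "m2 / (m1 + m2) + m1 / (m1 + m2) = 1"
    using nz by (simp_all add: add_divide_distrib [symmetric] add_ac)
  have "pos2 m1 m2 m3 q Q - pos1 m1 m2 m3 q Q = (m2 / (m1 + m2) + m1 / (m1 + m2)) *\<^sub>R q"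
    by (simp add: pos1_def pos2_def scaleR_add_left)
  then show "dist (pos1 m1 m2 m3 q Q) (pos2 m1 m2 m3 q Q) = norm q"
    by (metis M(2) dist_commute dist_norm scaleR_one)
  have "pos3 m1 m2 m3 q Q - pos1 m1 m2 m3 q Q =
      (m3 / (m1 + m2 + m3) + (m1 + m2) / (m1 + m2 + m3)) *\<^sub>R Q + (m2 / (m1 + m2)) *\<^sub>R q"
    by (simp only: pos1_def pos3_def scaleR_add_left scaleR_minus_left) simp
  then show "dist (pos1 m1 m2 m3 q Q) (pos3 m1 m2 m3 q Q) = norm (Q + (m2 / (m1 + m2)) *\<^sub>R q)"
    by (metis M(1) dist_commute dist_norm scaleR_one)
  have "pos3 m1 m2 m3 q Q - pos2 m1 m2 m3 q Q =
      (m3 / (m1 + m2 + m3) + (m1 + m2) / (m1 + m2 + m3)) *\<^sub>R Q - (m1 / (m1 + m2)) *\<^sub>R q"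
    by (simp only: pos2_def pos3_def scaleR_add_left scaleR_minus_left) simp
  then show "dist (pos2 m1 m2 m3 q Q) (pos3 m1 m2 m3 q Q) = norm (Q - (m1 / (m1 + m2)) *\<^sub>R q)"
    by (metis M(1) dist_commute dist_norm scaleR_one)
qed

end

theory Submission
  imports Defs
begin

text \<open>Let \<open>\<sigma>\<close> be the smallest singular value of \<open>L\<close>; it is positive as \<open>L\<close> has rank 4. Splitting off
  the Jacobi vector \<open>q\<close> of any pair of bodies leaves a bivector of rank at most 2, so
  \<open>|q| |p| \<ge> \<sigma>\<close> for the pair. Hence its internal energy is at least the energy of the circular
  Kepler motion with angular momentum \<open>\<sigma>\<close>. In a state whose energy is below this bound by a fixed
  amount, the third body must stay near the pair, since only its attraction can supply the
  difference. The infimum of the energy is indeed strictly below the bound for each pair: let the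
  pair move circularly in the plane of \<open>\<sigma>\<close> and the third body far away in the orthogonal plane.
  So a minimizing sequence has bounded distances. With \<open>m\<close> the smallest distance, the kinetic
  energy is at most of order \<open>1 / m\<close> and, by \<open>|q| |p| \<ge> \<sigma>\<close>, at least of order \<open>1 / m\<^sup>2\<close>,
  which bounds \<open>m\<close> from below and the momenta from above.\<close>

section \<open>Simple bivectors as operators\<close>

lemma wedge_mult_vec: "wedge a b *v w = (b \<bullet> w) *\<^sub>R a - (a \<bullet> w) *\<^sub>R b"
  by (simp add: wedge_def matrix_vector_mult_def inner_vec_def vec_eq_iff sum_4 algebra_simps)

lemma wedge_scaleR_left: "wedge (r *\<^sub>R a) b = r *\<^sub>R wedge a b"
  and wedge_scaleR_right: "wedge a (r *\<^sub>R b) = r *\<^sub>R wedge a b"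
  by (simp_all add: wedge_def vec_eq_iff algebra_simps)

text \<open>Pairing \<open>?y\<close> with itself gives a 2 by 2 determinant in the inner products
  of \<open>a\<close> and \<open>b\<close> with the orthogonal vectors \<open>?y\<close> and
  \<open>w\<close>; Lagrange's identity and Bessel's inequality bound it. The triangle inequality
  would cost a factor 2, which a comparison with exact Kepler energies cannot afford.\<close>

lemma norm_wedge_mult_vec_le: "norm (wedge a b *v w) \<le> norm a * norm b * norm w"
proof -
  let ?y = "wedge a b *v w"
  have "?y \<bullet> w = 0"
    by (simp add: wedge_mult_vec inner_diff_left)
  \<comment> \<open>Bessel's inequality for the orthogonal pair \<open>?y\<close>, \<open>w\<close>, multiplied out so that no case
    distinction on zero vectors is needed later.\<close>
  have bessel: "(c \<bullet> ?y)\<^sup>2 * (norm w)\<^sup>2 + (c \<bullet> w)\<^sup>2 * (norm ?y)\<^sup>2 \<le> (norm c * norm w * norm ?y)\<^sup>2" for c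
  proof (cases "w = 0 \<or> ?y = 0")
    case False
    define f where "f = c - ((c \<bullet> ?y) / (?y \<bullet> ?y)) *\<^sub>R ?y - ((c \<bullet> w) / (w \<bullet> w)) *\<^sub>R w"
    have "c \<bullet> f = c \<bullet> c - (c \<bullet> ?y)\<^sup>2 / (?y \<bullet> ?y) - (c \<bullet> w)\<^sup>2 / (w \<bullet> w)"
      by (simp add: f_def inner_diff_right power2_eq_square)
    moreover have "?y \<bullet> f = 0" "w \<bullet> f = 0"
      using False \<open>?y \<bullet> w = 0\<close>
      by (simp_all add: f_def inner_diff_right inner_commute[of w ?y] inner_commute[of c])
    then have "f \<bullet> f = c \<bullet> f"
      by (subst (1) f_def) (simp add: inner_diff_left)
    ultimately have "(c \<bullet> ?y)\<^sup>2 / (?y \<bullet> ?y) + (c \<bullet> w)\<^sup>2 / (w \<bullet> w) \<le> c \<bullet> c"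
      using inner_ge_zero[of f] by linarith
    moreover have "0 < ?y \<bullet> ?y" "0 < w \<bullet> w"
      using False by auto
    ultimately have "(c \<bullet> ?y)\<^sup>2 * (w \<bullet> w) + (c \<bullet> w)\<^sup>2 * (?y \<bullet> ?y) \<le> (c \<bullet> c) * (w \<bullet> w) * (?y \<bullet> ?y)"
      by (simp add: field_simps)
    then show ?thesis
      by (simp add: power_mult_distrib power2_norm_eq_inner)
  qed auto
  let ?n = "norm w" and ?m = "norm ?y"
  have eq: "?m\<^sup>2 = (a \<bullet> ?y) * (b \<bullet> w) - (b \<bullet> ?y) * (a \<bullet> w)"
    unfolding power2_norm_eq_inner
    by (subst (1) wedge_mult_vec) (simp add: inner_diff_left mult.commute)
  have lagrange: "(A * D - B * C)\<^sup>2 \<le> (A\<^sup>2 + C\<^sup>2) * (B\<^sup>2 + D\<^sup>2)" for A B C D :: real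
    using zero_le_power2[of "A * B + C * D"] by (simp add: power2_eq_square algebra_simps)
  have "(?m\<^sup>2 * (?n * ?m))\<^sup>2 =
      (((a \<bullet> ?y) * ?n) * ((b \<bullet> w) * ?m) - ((b \<bullet> ?y) * ?n) * ((a \<bullet> w) * ?m))\<^sup>2"
    unfolding eq by (simp add: algebra_simps)
  also have "\<dots> \<le> (((a \<bullet> ?y) * ?n)\<^sup>2 + ((a \<bullet> w) * ?m)\<^sup>2) * (((b \<bullet> ?y) * ?n)\<^sup>2 + ((b \<bullet> w) * ?m)\<^sup>2)"
    by (rule lagrange)
  also have "\<dots> \<le> (norm a * ?n * ?m)\<^sup>2 * (norm b * ?n * ?m)\<^sup>2"
    using bessel[of a] bessel[of b] by (intro mult_mono) (auto simp: power_mult_distrib)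
  also have "\<dots> = ((norm a * norm b * ?n * ?m) * (?n * ?m))\<^sup>2"
    by (simp add: power_mult_distrib)
  finally have "?m\<^sup>2 * (?n * ?m) \<le> (norm a * norm b * ?n * ?m) * (?n * ?m)"
    by (rule power2_le_imp_le) simp
  then have "(?n * ?m\<^sup>2) * ?m \<le> (?n * ?m\<^sup>2) * (norm a * norm b * ?n)"
    by (simp add: power2_eq_square algebra_simps)
  then show ?thesis
    by (cases "w = 0 \<or> ?y = 0") auto
qed

lemma exists_unit_orthogonal:
  fixes B :: "(real ^ 'n) set"
  assumes "finite B" "card B < CARD('n)"
  obtains z where "norm z = 1" "\<And>b. b \<in> B \<Longrightarrow> z \<bullet> b = 0"
proof -
  have "dim B < DIM(real ^ 'n)"
    using dim_le_card'[OF assms(1)] assms(2) by simp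
  then obtain y where "y \<noteq> 0" and y: "\<And>x. x \<in> span B \<Longrightarrow> orthogonal y x"
    using orthogonal_to_subspace_exists by blast
  then show thesis
    by (intro that[of "y /\<^sub>R norm y"]) (auto simp: orthogonal_def span_base)
qed

text \<open>On the vectors orthogonal to \<open>Q\<close> and \<open>P\<close> the matrix \<open>L\<close> acts as the first summand.\<close>

lemma wedge_norm_lower_bound:
  assumes "\<And>w. \<sigma> * norm w \<le> norm (L *v w)" and L: "L = wedge q p + wedge Q P"
  shows "\<sigma> \<le> norm q * norm p"
proof -
  have "card {Q, P} < CARD(4)"
    by (simp add: card_insert_if)
  then obtain z where z: "norm z = 1" "z \<bullet> Q = 0" "z \<bullet> P = 0"
    by (rule exists_unit_orthogonal[rotated]) auto
  then have "L *v z = wedge q p *v z"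
    by (simp add: L matrix_vector_mult_add_rdistrib wedge_mult_vec inner_commute)
  with norm_wedge_mult_vec_le[of q p z] assms(1)[of z] z(1) show ?thesis
    by simp
qed

section \<open>Normal form of a bivector of rank 4\<close>

lemma bivector_inner:
  assumes "bivector L"
  shows "(L *v a) \<bullet> b = - (a \<bullet> (L *v b))"
proof -
  have "(L *v a) \<bullet> b = a \<bullet> (transpose L *v b)"
    by (metis dot_lmul_matrix vector_transpose_matrix)
  also have "transpose L *v b = - (L *v b)"
    using assms matrix_vector_mult_diff_rdistrib[of 0 L b] by (simp add: bivector_def)
  finally show ?thesis by simp
qed

text \<open>The first-order condition at a minimum: at \<open>t = - g / k\<close> the linear term
  would outweigh the quadratic one.\<close>

lemma quadratic_nonneg_imp_zero:
  fixes g h :: real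
  assumes "\<And>t. 0 \<le> 2 * t * g + t\<^sup>2 * h"
  shows "g = 0"
proof (rule ccontr)
  assume "g \<noteq> 0"
  define k where "k = \<bar>h\<bar> + 1"
  have k: "k > 0" "h < k" by (auto simp: k_def)
  have "2 * (- g / k) * g + (- g / k)\<^sup>2 * h = g\<^sup>2 * (h - 2 * k) / k\<^sup>2"
    using k by (simp add: power2_eq_square field_simps)
  also have "\<dots> < 0"
    using k \<open>g \<noteq> 0\<close> by (intro divide_neg_pos mult_pos_neg) auto
  finally show False using assms[of "- g / k"] by linarith
qed

text \<open>The smallest singular value \<open>\<sigma>\<close> is attained at an eigenvector of \<open>L ** L\<close>, so that
  \<open>L\<close> preserves a plane and its orthogonal complement.\<close>

lemma bivector_normal_form:
  fixes L :: "real ^ 4 ^ 4"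
  assumes L: "bivector L" and "rank L = 4"
  obtains \<sigma> \<beta> x y u v where "\<sigma> > 0" "\<And>w. \<sigma> * norm w \<le> norm (L *v w)"
    "norm x = 1" "norm y = 1" "norm u = 1" "norm v = 1"
    "L = \<sigma> *\<^sub>R wedge y x + \<beta> *\<^sub>R wedge v u"
proof -
  have inj: "L *v w \<noteq> 0" if "w \<noteq> 0" for w
    using that assms(2) full_rank_injective[of L] injD[of "(*v) L" w 0] by auto
  have "continuous_on (sphere 0 1) (\<lambda>w. norm (L *v w))"
    by (intro continuous_intros)
  moreover have "sphere (0 :: vec4) 1 \<noteq> {}"
    by simp
  ultimately obtain x where x: "x \<in> sphere 0 1"
      and min: "\<And>w. w \<in> sphere 0 1 \<Longrightarrow> norm (L *v x) \<le> norm (L *v w)"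
    using continuous_attains_inf[of "sphere (0 :: vec4) 1" "\<lambda>w. norm (L *v w)"] by auto
  define \<sigma> where "\<sigma> = norm (L *v x)"
  have nx: "norm x = 1" using x by simp
  have "\<sigma> > 0" unfolding \<sigma>_def using inj[of x] nx by fastforce
  have lb: "\<sigma> * norm w \<le> norm (L *v w)" for w
  proof (cases "w = 0")
    case False
    then have "\<sigma> \<le> norm (L *v (w /\<^sub>R norm w))"
      unfolding \<sigma>_def by (intro min) simp
    with False show ?thesis
      by (simp add: matrix_vector_mult_scaleR field_simps)
  qed simp
  \<comment> \<open>The function \<open>norm (L *v w)^2 - \<sigma>^2 * norm w^2\<close> of
    \<open>w\<close> is nonnegative and vanishes at \<open>x\<close>, so all its directional
    derivatives vanish there; skewness of \<open>L\<close> turns this into the eigenvector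
    equation.\<close>
  have "L *v (L *v x) + \<sigma>\<^sup>2 *\<^sub>R x = 0"
  proof -
    have "(L *v x) \<bullet> (L *v w) - \<sigma>\<^sup>2 * (x \<bullet> w) = 0" for w
    proof (rule quadratic_nonneg_imp_zero)
      fix t
      have "(\<sigma> * norm (x + t *\<^sub>R w))\<^sup>2 \<le> (norm (L *v (x + t *\<^sub>R w)))\<^sup>2"
        using lb \<open>\<sigma> > 0\<close> by (intro power_mono) auto
      moreover have "(L *v x) \<bullet> (L *v x) = \<sigma>\<^sup>2" "x \<bullet> x = 1"
        using nx by (simp_all add: \<sigma>_def power2_norm_eq_inner flip: norm_eq_1)
      ultimately show "0 \<le> 2 * t * ((L *v x) \<bullet> (L *v w) - \<sigma>\<^sup>2 * (x \<bullet> w))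
          + t\<^sup>2 * ((L *v w) \<bullet> (L *v w) - \<sigma>\<^sup>2 * (w \<bullet> w))"
        by (simp add: power_mult_distrib power2_norm_eq_inner matrix_vector_right_distrib
            matrix_vector_mult_scaleR inner_add_left inner_add_right inner_commute
            power2_eq_square[of t] algebra_simps)
    qed
    then have "(L *v (L *v x) + \<sigma>\<^sup>2 *\<^sub>R x) \<bullet> w = 0" for w
      by (simp add: inner_add_left bivector_inner[OF L, of "L *v x"])
    then show ?thesis
      by (metis inner_eq_zero_iff)
  qed
  then have LLx: "L *v (L *v x) = - (\<sigma>\<^sup>2 *\<^sub>R x)"
    by (simp add: eq_neg_iff_add_eq_0)
  define y where "y = (1 / \<sigma>) *\<^sub>R (L *v x)"
  have Lx: "L *v x = \<sigma> *\<^sub>R y" and Ly: "L *v y = - (\<sigma> *\<^sub>R x)" and ny: "norm y = 1"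
    using \<open>\<sigma> > 0\<close> LLx
    by (simp_all add: y_def matrix_vector_mult_scaleR power2_eq_square \<sigma>_def[symmetric])
  have skew: "(L *v w) \<bullet> w = 0" for w
    using bivector_inner[OF L, of w w] by (simp add: inner_commute)
  have xy: "y \<bullet> x = 0"
    using skew[of x] \<open>\<sigma> > 0\<close> by (simp add: Lx)
  have "card {x, y} < CARD(4)"
    by (simp add: card_insert_if)
  then obtain u where u: "norm u = 1" "u \<bullet> x = 0" "u \<bullet> y = 0"
    by (rule exists_unit_orthogonal[rotated]) auto
  have "card {x, y, u} < CARD(4)"
    by (simp add: card_insert_if)
  then obtain v where v: "norm v = 1" "v \<bullet> x = 0" "v \<bullet> y = 0" "v \<bullet> u = 0"
    by (rule exists_unit_orthogonal[rotated]) auto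
  define S where "S = {x, y, u, v}"
  note inner1 = nx[unfolded norm_eq_1] ny[unfolded norm_eq_1]
    u(1)[unfolded norm_eq_1] v(1)[unfolded norm_eq_1]
  have orth: "y \<bullet> x = 0" "x \<bullet> y = 0" "u \<bullet> x = 0" "x \<bullet> u = 0" "u \<bullet> y = 0" "y \<bullet> u = 0"
    "v \<bullet> x = 0" "x \<bullet> v = 0" "v \<bullet> y = 0" "y \<bullet> v = 0" "v \<bullet> u = 0" "u \<bullet> v = 0"
    using xy u v by (simp_all add: inner_commute)
  have "x \<noteq> y" "x \<noteq> u" "x \<noteq> v" "y \<noteq> u" "y \<noteq> v" "u \<noteq> v"
    using orth inner1 by auto
  then have card: "card S = 4" by (simp add: S_def)
  have "pairwise orthogonal S" "0 \<notin> S"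
    using orth inner1 by (auto simp: pairwise_def S_def orthogonal_def)
  then have "independent S"
    by (rule pairwise_orthogonal_independent)
  then have "dim S = DIM(vec4)"
    using card by (simp add: dim_eq_card_independent)
  then have span: "span S = UNIV"
    by (simp only: dim_eq_full)
  have ext: "w = z" if "\<And>b. b \<in> S \<Longrightarrow> w \<bullet> b = z \<bullet> b" for w z
    using vector_eq_dot_span[of w S z] span that by (simp add: inner_commute)
  define \<beta> where "\<beta> = (L *v u) \<bullet> v"
  \<comment> \<open>\<open>L\<close> preserves the plane of \<open>x\<close> and \<open>y\<close>,
    hence by skewness its complement; as \<open>L *v u\<close> is also orthogonal to
    \<open>u\<close>, only the direction of \<open>v\<close> remains.\<close>
  have Lu: "L *v u = \<beta> *\<^sub>R v"
    using skew[of u] orth inner1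
    by (intro ext) (auto simp: S_def \<beta>_def bivector_inner[OF L, of u x] bivector_inner[OF L, of u y] Lx Ly)
  have Lv: "L *v v = - (\<beta> *\<^sub>R u)"
    using skew[of v] orth inner1
    by (intro ext) (auto simp: S_def bivector_inner[OF L, of v u] bivector_inner[OF L, of v x] bivector_inner[OF L, of v y] Lx Ly Lu)
  let ?M = "\<sigma> *\<^sub>R wedge y x + \<beta> *\<^sub>R wedge v u"
  have "L *v w = ?M *v w" for w
  proof (rule linear_eq_on_span[of "(*v) L" "(*v) ?M" S])
    show "L *v b = ?M *v b" if "b \<in> S" for b
      using that orth inner1
      by (auto simp: S_def Lx Ly Lu Lv matrix_vector_mult_add_rdistrib wedge_mult_vec
          simp flip: scaleR_matrix_vector_assoc)
  qed (auto simp: span)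
  then have "L = ?M"
    by (simp add: matrix_eq)
  then show thesis
    by (rule that[OF \<open>\<sigma> > 0\<close> lb nx ny u(1) v(1)])
qed

section \<open>Jacobi coordinates and relabelling of the bodies\<close>

lemma kinetic_jacobi:
  fixes p P :: "'a :: real_inner" and a b c :: real
  assumes "a > 0" "b > 0" "c > 0"
  shows "(norm (- p - (a / (a + b)) *\<^sub>R P))\<^sup>2 / (2 * a) + (norm (p - (b / (a + b)) *\<^sub>R P))\<^sup>2 / (2 * b)
      + (norm P)\<^sup>2 / (2 * c)
    = (norm p)\<^sup>2 / (2 * (a * b / (a + b))) + (norm P)\<^sup>2 / (2 * (c * (a + b) / (a + b + c)))"
proof -
  \<comment> \<open>\<open>A\<close>, \<open>B\<close>, \<open>C\<close> stand for
    \<open>p \<bullet> p\<close>, \<open>p \<bullet> P\<close>, \<open>P \<bullet> P\<close>.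
    Splitting \<open>P\<close> in proportion to the masses makes the terms in \<open>B\<close>
    cancel.\<close>
  have *: "(A + 2 * (a / (a + b)) * B + (a / (a + b))\<^sup>2 * C) / (2 * a)
      + (A - 2 * (b / (a + b)) * B + (b / (a + b))\<^sup>2 * C) / (2 * b) + C / (2 * c)
    = A / (2 * (a * b / (a + b))) + C / (2 * (c * (a + b) / (a + b + c)))" for A B C :: real
  proof -
    define M where "M = a + b"
    have M: "M > 0" "M + c > 0" "a = M - b" using assms by (auto simp: M_def)
    have "(A + 2 * (a / M) * B + (a / M)\<^sup>2 * C) / (2 * a) = A / (2 * a) + B / M + a * C / (2 * M\<^sup>2)"
      using assms M(1,2) by (simp add: field_simps power2_eq_square)
    moreover have "(A - 2 * (b / M) * B + (b / M)\<^sup>2 * C) / (2 * b) = A / (2 * b) - B / M + b * C / (2 * M\<^sup>2)"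
      using assms M(1,2) by (simp add: field_simps power2_eq_square)
    moreover have "A / (2 * a) + A / (2 * b) = A / (2 * (a * b / M))"
      using assms M(1,2) by (simp add: field_simps M_def)
    moreover have "a * C / (2 * M\<^sup>2) + b * C / (2 * M\<^sup>2) = C / (2 * M)"
    proof -
      have "a * C / (2 * M\<^sup>2) + b * C / (2 * M\<^sup>2) = M * C / (2 * M\<^sup>2)"
        by (simp add: M_def distrib_right add_divide_distrib)
      then show ?thesis by (simp add: power2_eq_square)
    qed
    moreover have "C / (2 * M) + C / (2 * c) = C / (2 * (c * M / (M + c)))"
      using assms M(1,2) by (simp add: field_simps)
    ultimately show ?thesis
      by (simp flip: M_def)
  qed
  have "(norm (- p - t *\<^sub>R P))\<^sup>2 = (norm p)\<^sup>2 + 2 * t * (p \<bullet> P) + t\<^sup>2 * (norm P)\<^sup>2"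
    and "(norm (p - t *\<^sub>R P))\<^sup>2 = (norm p)\<^sup>2 - 2 * t * (p \<bullet> P) + t\<^sup>2 * (norm P)\<^sup>2" for t
    unfolding power2_norm_eq_inner
    by (simp_all add: inner_diff_left inner_diff_right inner_commute[of P p] power2_eq_square algebra_simps)
  then show ?thesis
    by (simp only: *)
qed

lemma wedge_jacobi:
  "wedge x1 (- p - t *\<^sub>R P) + wedge x2 (p - u *\<^sub>R P) + wedge x3 P
    = wedge (x2 - x1) p + wedge (x3 - t *\<^sub>R x1 - u *\<^sub>R x2) P"
  by (simp add: vec_eq_iff wedge_def algebra_simps)

text \<open>Recording only the kinetic energy and the mutual distances makes the three bodies play
  symmetric roles, in contrast to Jacobi coordinates. The bodies have positions \<open>x1\<close>, \<open>x2\<close>, \<open>x3\<close>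
  and linear momenta \<open>y1\<close>, \<open>y2\<close>, \<open>y3\<close>; by translation invariance the center of mass is free.\<close>

definition configuration ::
    "real \<Rightarrow> real \<Rightarrow> real \<Rightarrow> real ^ 4 ^ 4 \<Rightarrow> real \<Rightarrow> real \<Rightarrow> real \<Rightarrow> real \<Rightarrow> bool" where
  "configuration a b c L T d12 d13 d23 \<longleftrightarrow> (\<exists>x1 x2 x3 y1 y2 y3.
     y1 + y2 + y3 = 0 \<and> wedge x1 y1 + wedge x2 y2 + wedge x3 y3 = L \<and>
     T = (norm y1)\<^sup>2 / (2 * a) + (norm y2)\<^sup>2 / (2 * b) + (norm y3)\<^sup>2 / (2 * c) \<and>
     d12 = dist x1 x2 \<and> d13 = dist x1 x3 \<and> d23 = dist x2 x3 \<and> 0 < d12 \<and> 0 < d13 \<and> 0 < d23)"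

text \<open>The two transpositions generate all relabellings, so estimates for the first two bodies
  apply to every pair.\<close>

lemma configuration_swap12: "configuration a b c L T d12 d13 d23 \<Longrightarrow> configuration b a c L T d12 d23 d13"
  unfolding configuration_def
  apply (elim exE)
  subgoal for x1 x2 x3 y1 y2 y3
    by (rule exI[of _ x2], rule exI[of _ x1], rule exI[of _ x3], rule exI[of _ y2], rule exI[of _ y1], rule exI[of _ y3])
      (auto simp: add_ac dist_commute)
  done

lemma configuration_swap23: "configuration a b c L T d12 d13 d23 \<Longrightarrow> configuration a c b L T d13 d12 d23"
  unfolding configuration_def
  apply (elim exE)
  subgoal for x1 x2 x3 y1 y2 y3
    by (rule exI[of _ x1], rule exI[of _ x3], rule exI[of _ x2], rule exI[of _ y1], rule exI[of _ y3], rule exI[of _ y2])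
      (auto simp: add_ac dist_commute)
  done

lemma configuration_triangle: "configuration a b c L T d12 d13 d23 \<Longrightarrow> d23 \<le> d12 + d13"
  unfolding configuration_def by (metis dist_triangle dist_commute)

lemma configuration_iff_jacobi:
  assumes "a > 0" "b > 0" "c > 0"
  shows "configuration a b c L T d12 d13 d23 \<longleftrightarrow> (\<exists>q p Q P. L = wedge q p + wedge Q P \<and>
     T = (norm p)\<^sup>2 / (2 * (a * b / (a + b))) + (norm P)\<^sup>2 / (2 * (c * (a + b) / (a + b + c))) \<and>
     d12 = norm q \<and> d13 = norm (Q + (b / (a + b)) *\<^sub>R q) \<and> d23 = norm (Q - (a / (a + b)) *\<^sub>R q) \<and>
     0 < d12 \<and> 0 < d13 \<and> 0 < d23)" (is "_ \<longleftrightarrow> ?rhs")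
proof -
  define \<alpha> \<beta> where ab: "\<alpha> = a / (a + b)" "\<beta> = b / (a + b)"
  have 1: "\<alpha> + \<beta> = 1"
    using assms by (simp add: ab flip: add_divide_distrib)
  then have \<alpha>: "\<alpha> = 1 - \<beta>" by simp
  show ?thesis
  proof
    assume "configuration a b c L T d12 d13 d23"
    then obtain x1 x2 x3 y1 y2 y3 where y: "y1 + y2 + y3 = 0"
      and L: "wedge x1 y1 + wedge x2 y2 + wedge x3 y3 = L"
      and T: "T = (norm y1)\<^sup>2 / (2 * a) + (norm y2)\<^sup>2 / (2 * b) + (norm y3)\<^sup>2 / (2 * c)"
      and d: "d12 = dist x1 x2" "d13 = dist x1 x3" "d23 = dist x2 x3"
      and pos: "0 < d12" "0 < d13" "0 < d23"
      unfolding configuration_def by blast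
    define q p Q where qpQ: "q = x2 - x1" "p = y2 + \<beta> *\<^sub>R y3" "Q = x3 - \<alpha> *\<^sub>R x1 - \<beta> *\<^sub>R x2"
    have "y1 = - y2 - y3"
      using y by (simp add: eq_neg_iff_add_eq_0 algebra_simps)
    then have y12: "y1 = - p - \<alpha> *\<^sub>R y3" "y2 = p - \<beta> *\<^sub>R y3"
      by (simp_all add: qpQ \<alpha> algebra_simps)
    have "L = wedge q p + wedge Q y3"
      unfolding L[symmetric] y12 qpQ(1,3) by (rule wedge_jacobi)
    moreover have "T = (norm p)\<^sup>2 / (2 * (a * b / (a + b))) + (norm y3)\<^sup>2 / (2 * (c * (a + b) / (a + b + c)))"
      unfolding T y12 ab using assms by (intro kinetic_jacobi)
    moreover have "Q + \<beta> *\<^sub>R q = x3 - x1" "Q - \<alpha> *\<^sub>R q = x3 - x2"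
      by (simp_all add: qpQ \<alpha> algebra_simps)
    then have "d12 = norm q" "d13 = norm (Q + \<beta> *\<^sub>R q)" "d23 = norm (Q - \<alpha> *\<^sub>R q)"
      by (simp_all add: d dist_norm norm_minus_commute qpQ(1))
    ultimately show ?rhs
      using pos unfolding ab by blast
  next
    assume ?rhs
    then obtain q p Q P where L: "L = wedge q p + wedge Q P"
      and T: "T = (norm p)\<^sup>2 / (2 * (a * b / (a + b))) + (norm P)\<^sup>2 / (2 * (c * (a + b) / (a + b + c)))"
      and d: "d12 = norm q" "d13 = norm (Q + \<beta> *\<^sub>R q)" "d23 = norm (Q - \<alpha> *\<^sub>R q)"
      and pos: "0 < d12" "0 < d13" "0 < d23"
      unfolding ab by blast
    \<comment> \<open>The first body is put at the origin: with total momentum zero, the angular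
      momentum does not depend on the choice of origin.\<close>
    define y1 y2 x3 where yx: "y1 = - p - \<alpha> *\<^sub>R P" "y2 = p - \<beta> *\<^sub>R P" "x3 = Q + \<beta> *\<^sub>R q"
    have "y1 + y2 + P = 0"
      by (simp add: yx \<alpha> algebra_simps)
    moreover have "wedge 0 y1 + wedge q y2 + wedge x3 P = L"
      unfolding L yx(1,2) by (subst wedge_jacobi) (simp add: yx(3))
    moreover have "T = (norm y1)\<^sup>2 / (2 * a) + (norm y2)\<^sup>2 / (2 * b) + (norm P)\<^sup>2 / (2 * c)"
      unfolding T yx ab using assms by (intro kinetic_jacobi[symmetric])
    moreover have "d12 = dist 0 q" "d13 = dist 0 x3"
      by (simp_all add: d yx(3))
    moreover have "Q - \<alpha> *\<^sub>R q = x3 - q"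
      by (simp add: yx \<alpha> algebra_simps)
    then have "d23 = dist q x3"
      by (simp add: d dist_norm norm_minus_commute)
    ultimately show "configuration a b c L T d12 d13 d23"
      using pos unfolding configuration_def by blast
  qed
qed

lemma configuration_jacobi:
  assumes "a > 0" "b > 0" "c > 0" "L = wedge q p + wedge Q P"
    "0 < norm q" "0 < norm (Q + (b / (a + b)) *\<^sub>R q)" "0 < norm (Q - (a / (a + b)) *\<^sub>R q)"
  shows "configuration a b c L
    ((norm p)\<^sup>2 / (2 * (a * b / (a + b))) + (norm P)\<^sup>2 / (2 * (c * (a + b) / (a + b + c))))
    (norm q) (norm (Q + (b / (a + b)) *\<^sub>R q)) (norm (Q - (a / (a + b)) *\<^sub>R q))"
  unfolding configuration_iff_jacobi[OF assms(1-3)] using assms(4-7) by blast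

lemma in_level_set_iff:
  assumes "a > 0" "b > 0" "c > 0"
  shows "(q, p, Q, P) \<in> level_set a b c L \<longleftrightarrow> L = wedge q p + wedge Q P \<and> 0 < norm q \<and>
    0 < norm (Q + (b / (a + b)) *\<^sub>R q) \<and> 0 < norm (Q - (a / (a + b)) *\<^sub>R q)"
  unfolding level_set_def states_def angular_momentum_def
  by (simp only: mem_Collect_eq prod.case zero_less_dist_iff[symmetric] dist_pos[OF assms]) blast

lemma energy_eq:
  assumes "a > 0" "b > 0" "c > 0"
  shows "energy a b c (q, p, Q, P) = kinetic a b c (q, p, Q, P) - a * b / norm q
    - a * c / norm (Q + (b / (a + b)) *\<^sub>R q) - b * c / norm (Q - (a / (a + b)) *\<^sub>R q)"
  by (simp add: energy_def potential_def dist_pos[OF assms])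

lemma configuration_of_level_set:
  assumes "a > 0" "b > 0" "c > 0" "(q, p, Q, P) \<in> level_set a b c L"
  shows "configuration a b c L (kinetic a b c (q, p, Q, P)) (norm q)
    (norm (Q + (b / (a + b)) *\<^sub>R q)) (norm (Q - (a / (a + b)) *\<^sub>R q))"
  using assms(4) configuration_jacobi[OF assms(1-3), of L q p Q P]
  by (simp add: in_level_set_iff[OF assms(1-3)] kinetic_def)

text \<open>Turns trial configurations into states, which bound \<open>H_inf\<close> from
  above.\<close>

lemma level_set_of_configuration:
  assumes "a > 0" "b > 0" "c > 0" "configuration a b c L T d12 d13 d23"
  obtains s where "s \<in> level_set a b c L"
    "energy a b c s = T - a * b / d12 - a * c / d13 - b * c / d23"
proof -
  from assms(4) obtain q p Q P where "L = wedge q p + wedge Q P"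
    "T = (norm p)\<^sup>2 / (2 * (a * b / (a + b))) + (norm P)\<^sup>2 / (2 * (c * (a + b) / (a + b + c)))"
    "d12 = norm q" "d13 = norm (Q + (b / (a + b)) *\<^sub>R q)" "d23 = norm (Q - (a / (a + b)) *\<^sub>R q)"
    "0 < d12" "0 < d13" "0 < d23"
    unfolding configuration_iff_jacobi[OF assms(1-3)] by blast
  then show thesis
    by (intro that[of "(q, p, Q, P)"])
      (simp_all only: in_level_set_iff[OF assms(1-3)] energy_eq[OF assms(1-3)],
       simp_all add: kinetic_def Let_def)
qed

section \<open>Energy estimates\<close>

lemma kinetic_lower_bound:
  assumes "a > 0" "b > 0" "c > 0" "\<sigma> > 0" and \<sigma>: "\<And>w. \<sigma> * norm w \<le> norm (L *v w)"
    and "configuration a b c L T d12 d13 d23"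
  shows "\<sigma>\<^sup>2 \<le> 2 * (a * b / (a + b)) * d12\<^sup>2 * T"
proof -
  from assms(6) obtain q p Q P where L: "L = wedge q p + wedge Q P"
    and T: "T = (norm p)\<^sup>2 / (2 * (a * b / (a + b))) + (norm P)\<^sup>2 / (2 * (c * (a + b) / (a + b + c)))"
    and d: "d12 = norm q"
    unfolding configuration_iff_jacobi[OF assms(1-3)] by blast
  have "(norm p)\<^sup>2 / (2 * (a * b / (a + b))) \<le> T"
    unfolding T using assms(1-3) by simp
  then have "(norm p)\<^sup>2 \<le> 2 * (a * b / (a + b)) * T"
    using assms(1-3) by (subst (asm) pos_divide_le_eq) (auto simp: mult_ac)
  then have "(norm q)\<^sup>2 * (norm p)\<^sup>2 \<le> (norm q)\<^sup>2 * (2 * (a * b / (a + b)) * T)"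
    by (rule mult_left_mono) simp
  moreover have "\<sigma>\<^sup>2 \<le> (norm q * norm p)\<^sup>2"
    using wedge_norm_lower_bound[OF \<sigma> L] \<open>\<sigma> > 0\<close> by (intro power_mono) auto
  ultimately show ?thesis
    by (simp add: d power_mult_distrib mult_ac)
qed

text \<open>The energy of the circular Kepler motion of two bodies with angular momentum \<open>\<sigma>\<close>.\<close>

definition kepler_energy :: "real \<Rightarrow> real \<Rightarrow> real \<Rightarrow> real" where
  "kepler_energy a b \<sigma> = - ((a * b)\<^sup>2 * (a * b / (a + b)) / (2 * \<sigma>\<^sup>2))"

text \<open>Completing the square in \<open>1 / d\<close> minimizes the effective potential
  \<open>\<sigma>^2 / (2 * \<mu> * d^2) - k / d\<close>.\<close>

lemma kepler_energy_le:
  assumes "a > 0" "b > 0" "\<sigma> > 0" "d > 0" and "\<sigma>\<^sup>2 \<le> 2 * (a * b / (a + b)) * d\<^sup>2 * T"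
  shows "kepler_energy a b \<sigma> \<le> T - a * b / d"
proof -
  define k \<mu> where "k = a * b" and "\<mu> = a * b / (a + b)"
  have pos: "k > 0" "\<mu> > 0" using assms by (auto simp: k_def \<mu>_def)
  have kepler: "kepler_energy a b \<sigma> = - (k\<^sup>2 * \<mu> / (2 * \<sigma>\<^sup>2))"
    unfolding kepler_energy_def k_def \<mu>_def ..
  have "\<sigma>\<^sup>2 / (2 * \<mu> * d\<^sup>2) \<le> T"
    using assms(5) pos assms(4) by (simp add: pos_divide_le_eq mult_ac flip: \<mu>_def)
  moreover have "\<sigma>\<^sup>2 / (2 * \<mu> * d\<^sup>2) - k / d + k\<^sup>2 * \<mu> / (2 * \<sigma>\<^sup>2) = (\<sigma> / d - k * \<mu> / \<sigma>)\<^sup>2 / (2 * \<mu>)"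
    using pos assms(3,4) by (simp add: power2_eq_square field_simps)
  moreover have "(\<sigma> / d - k * \<mu> / \<sigma>)\<^sup>2 / (2 * \<mu>) \<ge> 0"
    using pos by simp
  ultimately show ?thesis
    unfolding kepler k_def[symmetric] by linarith
qed

text \<open>Two bodies move circularly in the plane of \<open>\<sigma>\<close> while the third one is at a large distance \<open>R\<close>
  in the complementary plane: its attraction is of order \<open>1 / R\<close> and beats its kinetic energy,
  which is of order \<open>1 / R\<^sup>2\<close>.\<close>

lemma configuration_below_kepler_energy:
  assumes "a > 0" "b > 0" "c > 0" "\<sigma> > 0"
    and "norm x = 1" "norm y = 1" "norm u = 1" "norm v = 1"
    and L: "L = \<sigma> *\<^sub>R wedge y x + \<beta> *\<^sub>R wedge v u"
  obtains T d12 d13 d23 where "configuration a b c L T d12 d13 d23"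
    "T - a * b / d12 - a * c / d13 - b * c / d23 < kepler_energy a b \<sigma>"
proof -
  define k \<mu> \<nu> g where "k = a * b" and "\<mu> = a * b / (a + b)" and "\<nu> = c * (a + b) / (a + b + c)"
    and "g = c * (a + b)"
  have pos: "k > 0" "\<mu> > 0" "\<nu> > 0" "g > 0"
    using assms(1-3) by (auto simp: k_def \<mu>_def \<nu>_def g_def)
  have kepler: "kepler_energy a b \<sigma> = - (k\<^sup>2 * \<mu> / (2 * \<sigma>\<^sup>2))"
    unfolding kepler_energy_def k_def \<mu>_def ..
  \<comment> \<open>The radius of the circular motion, where the effective potential attains its
    minimum.\<close>
  define r where "r = \<sigma>\<^sup>2 / (\<mu> * k)"
  \<comment> \<open>\<open>R > r\<close> keeps the third body off the pair, at distances at most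
    \<open>2 * R\<close>. The second summand makes the kinetic term of \<open>P\<close> smaller than
    \<open>g / (2 * R)\<close>, a lower bound for the attraction.\<close>
  define R where "R = r + \<beta>\<^sup>2 / (\<nu> * g) + 1"
  have r: "r > 0" using pos \<open>\<sigma> > 0\<close> by (simp add: r_def)
  have "\<beta>\<^sup>2 / (\<nu> * g) \<ge> 0" using pos by simp
  then have R: "R > r" "R > 0" "\<beta>\<^sup>2 / (\<nu> * g) < R" using r by (simp_all add: R_def)
  define q p Q P where qp: "q = r *\<^sub>R y" "p = (\<sigma> / r) *\<^sub>R x" "Q = R *\<^sub>R v" "P = (\<beta> / R) *\<^sub>R u"
  define T where "T = (norm p)\<^sup>2 / (2 * \<mu>) + (norm P)\<^sup>2 / (2 * \<nu>)"
  define d13 d23 where d: "d13 = norm (Q + (b / (a + b)) *\<^sub>R q)" "d23 = norm (Q - (a / (a + b)) *\<^sub>R q)"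
  have n: "norm q = r" "norm Q = R" "(norm p)\<^sup>2 = \<sigma>\<^sup>2 / r\<^sup>2" "(norm P)\<^sup>2 = \<beta>\<^sup>2 / R\<^sup>2"
    using r R(2) assms(5-8) by (simp_all add: qp power_divide)
  have fr: "norm (f *\<^sub>R q) \<le> r" if "0 < f" "f \<le> 1" for f
    using that r by (simp add: n mult_left_le_one_le)
  have b1: "norm ((b / (a + b)) *\<^sub>R q) \<le> r" and a1: "norm ((a / (a + b)) *\<^sub>R q) \<le> r"
    using assms(1,2) by (intro fr; simp)+
  have d13: "0 < d13" "d13 \<le> 2 * R"
    using norm_diff_ineq[of Q "(b / (a + b)) *\<^sub>R q"] norm_triangle_ineq[of Q "(b / (a + b)) *\<^sub>R q"]
      b1 R(1) unfolding d n(2) by linarith+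
  have d23: "0 < d23" "d23 \<le> 2 * R"
    using norm_triangle_ineq2[of Q "(a / (a + b)) *\<^sub>R q"] norm_triangle_ineq4[of Q "(a / (a + b)) *\<^sub>R q"]
      a1 R(1) unfolding d n(2) by linarith+
  have "L = wedge q p + wedge Q P"
    using r R(2) by (simp add: L qp wedge_scaleR_left wedge_scaleR_right)
  then have "configuration a b c L T r d13 d23"
    using configuration_jacobi[OF assms(1-3), of L q p Q P] d13(1) d23(1) r
    by (simp only: n(1) d T_def \<mu>_def \<nu>_def)
  moreover have "T - a * b / r - a * c / d13 - b * c / d23 < kepler_energy a b \<sigma>"
  proof -
    have "\<sigma>\<^sup>2 / r\<^sup>2 / (2 * \<mu>) - k / r = kepler_energy a b \<sigma>"
      using pos \<open>\<sigma> > 0\<close>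
      unfolding kepler
      by (simp add: r_def power2_eq_square field_simps)
    moreover have "a * c / (2 * R) \<le> a * c / d13" "b * c / (2 * R) \<le> b * c / d23"
      using d13 d23 assms(1-3) by (auto intro!: divide_left_mono)
    moreover have "a * c / (2 * R) + b * c / (2 * R) = g / (2 * R)"
      by (simp add: g_def algebra_simps add_divide_distrib)
    moreover have "\<beta>\<^sup>2 / R\<^sup>2 / (2 * \<nu>) < g / (2 * R)"
      using R pos by (simp add: field_simps power2_eq_square)
    ultimately show ?thesis
      unfolding T_def n k_def by linarith
  qed
  ultimately show thesis by (rule that)
qed

text \<open>The pair contributes at least \<open>kepler_energy a b \<sigma>\<close>; the bound is
  the common distance at which the attraction of the third body is exactly the deficit down to
  \<open>e\<close>.\<close>

lemma third_body_near:
  assumes "a > 0" "b > 0" "c > 0" "\<sigma> > 0" and \<sigma>: "\<And>w. \<sigma> * norm w \<le> norm (L *v w)"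
    and conf: "configuration a b c L T d12 d13 d23"
    and e: "T - a * b / d12 - a * c / d13 - b * c / d23 \<le> e" "e < kepler_energy a b \<sigma>"
  shows "min d13 d23 \<le> (a * c + b * c) / (kepler_energy a b \<sigma> - e)"
proof (rule ccontr)
  define D where "D = (a * c + b * c) / (kepler_energy a b \<sigma> - e)"
  assume "\<not> ?thesis"
  then have D: "D < d13" "D < d23" by (auto simp: D_def)
  have "D > 0" unfolding D_def using assms(1-3) e(2) by (intro divide_pos_pos add_pos_pos) auto
  then have "a * c / d13 < a * c / D" "b * c / d23 < b * c / D"
    using D assms(1-3) by (auto intro!: divide_strict_left_mono)
  moreover have "a * c / D + b * c / D = kepler_energy a b \<sigma> - e"
    unfolding add_divide_distrib[symmetric] using e(2) assms(1-3)
    by (simp add: D_def add_pos_pos less_imp_neq[symmetric])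
  moreover have "d12 > 0" using conf by (auto simp: configuration_def)
  then have "kepler_energy a b \<sigma> \<le> T - a * b / d12"
    using assms by (intro kepler_energy_le kinetic_lower_bound)
  ultimately show False using e by linarith
qed

text \<open>The level \<open>e\<close> lies below the Kepler energy of every pair because any of the
  bodies might be the one that moves away.\<close>

lemma configuration_bounded:
  assumes "a > 0" "b > 0" "c > 0" "\<sigma> > 0" and \<sigma>: "\<And>w. \<sigma> * norm w \<le> norm (L *v w)"
    and "e < kepler_energy a b \<sigma>" "e < kepler_energy a c \<sigma>" "e < kepler_energy b c \<sigma>"
  obtains B where "\<And>T d12 d13 d23. configuration a b c L T d12 d13 d23 \<Longrightarrow>
    T - a * b / d12 - a * c / d13 - b * c / d23 \<le> e \<Longrightarrow> T \<le> B \<and> d12 \<le> B \<and> d13 \<le> B"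
proof -
  define D where "D = Max {(a * c + b * c) / (kepler_energy a b \<sigma> - e),
    (a * b + c * b) / (kepler_energy a c \<sigma> - e), (b * a + c * a) / (kepler_energy b c \<sigma> - e)}"
  \<comment> \<open>\<open>K\<close> collects the coupling constants; \<open>S\<close> dominates all
    three reduced masses, so it serves whichever pair is closest.\<close>
  define K S where "K = a * b + a * c + b * c" and "S = a * b / (a + b) + a * c / (a + c) + b * c / (b + c)"
  have KS: "K > 0" "S > 0" using assms(1-3) by (auto simp: K_def S_def intro!: add_pos_pos)
  have "kepler_energy a b \<sigma> < 0"
    using assms(1-4) by (simp add: kepler_energy_def)
  then have "e < 0" using assms(6) by simp
  have "T \<le> max (2 * S * K\<^sup>2 / \<sigma>\<^sup>2) (2 * D) \<and> d12 \<le> max (2 * S * K\<^sup>2 / \<sigma>\<^sup>2) (2 * D) \<and> d13 \<le> max (2 * S * K\<^sup>2 / \<sigma>\<^sup>2) (2 * D)"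
    if conf: "configuration a b c L T d12 d13 d23"
      and e: "T - a * b / d12 - a * c / d13 - b * c / d23 \<le> e" for T d12 d13 d23
  proof -
    note conf13 = configuration_swap23[OF conf]
    note conf23 = configuration_swap23[OF configuration_swap12[OF conf]]
    have pos: "d12 > 0" "d13 > 0" "d23 > 0" and "T \<ge> 0"
      using conf assms(1-3) by (auto simp: configuration_def)
    have "min d13 d23 \<le> D" "min d12 d23 \<le> D" "min d12 d13 \<le> D"
      using third_body_near[OF assms(1,2,3,4) \<sigma> conf, of e] third_body_near[OF assms(1,3,2,4) \<sigma> conf13, of e]
        third_body_near[OF assms(2,3,1,4) \<sigma> conf23, of e] e assms(6-8)
      by (auto simp: D_def mult.commute le_max_iff_disj)
    \<comment> \<open>Any two of the distances include one that is at most \<open>D\<close>, so at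
      most one exceeds \<open>D\<close>, and the triangle inequality bounds it by
      \<open>2 * D\<close>.\<close>
    then have d: "d12 \<le> 2 * D" "d13 \<le> 2 * D"
      using pos configuration_triangle[OF conf] configuration_triangle[OF configuration_swap12[OF conf]]
        configuration_triangle[OF configuration_swap12[OF conf13]]
      unfolding min_def by (simp_all split: if_splits)
    define m where "m = min d12 (min d13 d23)"
    have m: "m > 0" "m \<le> d12" "m \<le> d13" "m \<le> d23" using pos by (auto simp: m_def)
    have "a * b / d12 \<le> a * b / m" "a * c / d13 \<le> a * c / m" "b * c / d23 \<le> b * c / m"
      using m pos assms(1-3) by (auto intro!: divide_left_mono)
    \<comment> \<open>Each attraction is at most its value at distance \<open>m\<close>, and the
      energy is negative.\<close>
    then have TK: "T \<le> K / m"
      using e \<open>e < 0\<close> unfolding K_def add_divide_distrib by linarith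
    have "\<sigma>\<^sup>2 \<le> 2 * S * m\<^sup>2 * T"
    proof -
      have *: "2 * f * m\<^sup>2 * T \<le> 2 * S * m\<^sup>2 * T" if "f \<le> S" for f
        using that \<open>T \<ge> 0\<close> by (intro mult_right_mono) auto
      have S: "a * b / (a + b) \<le> S" "a * c / (a + c) \<le> S" "b * c / (b + c) \<le> S"
        using assms(1-3) by (auto simp: S_def)
      have "m = d12 \<or> m = d13 \<or> m = d23" by (auto simp: m_def min_def)
      then show ?thesis
        using kinetic_lower_bound[OF assms(1,2,3,4) \<sigma> conf] kinetic_lower_bound[OF assms(1,3,2,4) \<sigma> conf13]
          kinetic_lower_bound[OF assms(2,3,1,4) \<sigma> conf23] *[OF S(1)] *[OF S(2)] *[OF S(3)]
        by (elim disjE) simp_all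
    qed
    also have "\<dots> \<le> 2 * S * m\<^sup>2 * (K / m)"
      using TK KS by (intro mult_left_mono) auto
    also have "\<dots> = 2 * S * K * m"
      using m by (simp add: power2_eq_square)
    \<comment> \<open>This keeps \<open>m\<close> away from zero, and \<open>K / m\<close> in turn
      bounds \<open>T\<close>.\<close>
    finally have "K / m \<le> 2 * S * K\<^sup>2 / \<sigma>\<^sup>2"
      using m KS \<open>\<sigma> > 0\<close> by (simp add: field_simps power2_eq_square)
    with TK d show ?thesis by auto
  qed
  then show thesis by (rule that)
qed

section \<open>Boundedness of minimizing sequences\<close>

theorem proposition6:
  fixes m1 m2 m3 :: real and L :: "real ^ 4 ^ 4" and s :: "nat \<Rightarrow> state"
  assumes "m1 > 0" and "m2 > 0" and "m3 > 0"
    and "bivector L" and "rank L = 4"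
    and "\<And>n. s n \<in> level_set m1 m2 m3 L"
    and "(\<lambda>n. ereal (energy m1 m2 m3 (s n))) \<longlonglongrightarrow> H_inf m1 m2 m3 L"
  shows "bounded (range s)"
proof -
  note m = assms(1-3)
  obtain \<sigma> \<beta> x y u v where \<sigma>: "\<sigma> > 0" and lb: "\<And>w. \<sigma> * norm w \<le> norm (L *v w)"
    and nf: "norm x = 1" "norm y = 1" "norm u = 1" "norm v = 1"
      "L = \<sigma> *\<^sub>R wedge y x + \<beta> *\<^sub>R wedge v u"
    using bivector_normal_form[OF assms(4,5)] by metis
  define E where "E = Min {kepler_energy m1 m2 \<sigma>, kepler_energy m1 m3 \<sigma>, kepler_energy m2 m3 \<sigma>}"
  have below: "H_inf m1 m2 m3 L < ereal f"
    if conf: "configuration m1 m2 m3 L T d12 d13 d23" and f: "T - m1 * m2 / d12 - m1 * m3 / d13 - m2 * m3 / d23 < f"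
    for T d12 d13 d23 f
  proof -
    obtain t where "t \<in> level_set m1 m2 m3 L" "energy m1 m2 m3 t < f"
      using level_set_of_configuration[OF m conf] f by metis
    then show ?thesis
      unfolding H_inf_def by (auto simp: INF_less_iff)
  qed
  \<comment> \<open>The normal form of \<open>L\<close> does not involve the masses, so each pair in
    turn can be the one in the plane of \<open>\<sigma>\<close>.\<close>
  have "H_inf m1 m2 m3 L < kepler_energy m1 m2 \<sigma>"
    by (rule configuration_below_kepler_energy[OF m(1,2,3) \<sigma> nf]) (rule below)
  moreover have "H_inf m1 m2 m3 L < kepler_energy m1 m3 \<sigma>"
    by (rule configuration_below_kepler_energy[OF m(1,3,2) \<sigma> nf], drule configuration_swap23, erule below)
      (simp add: mult.commute)
  moreover have "H_inf m1 m2 m3 L < kepler_energy m2 m3 \<sigma>"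
    by (rule configuration_below_kepler_energy[OF m(2,3,1) \<sigma> nf],
        drule configuration_swap23, drule configuration_swap12, erule below)
      (simp add: mult.commute)
  ultimately have "H_inf m1 m2 m3 L < ereal E"
    by (simp add: E_def min_def)
  \<comment> \<open>The gap below \<open>E\<close> is the fixed deficit for
    \<open>third_body_near\<close>; the energies eventually lie below \<open>e\<close>.\<close>
  then obtain e where e: "H_inf m1 m2 m3 L < ereal e" "e < E"
    by (metis ereal_dense2 less_ereal.simps(1))
  obtain B where B: "\<And>T d12 d13 d23. configuration m1 m2 m3 L T d12 d13 d23 \<Longrightarrow>
      T - m1 * m2 / d12 - m1 * m3 / d13 - m2 * m3 / d23 \<le> e \<Longrightarrow> T \<le> B \<and> d12 \<le> B \<and> d13 \<le> B"
    using configuration_bounded[OF m \<sigma> lb, of e] e(2) by (auto simp: E_def)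
  define \<mu> \<nu> where "\<mu> = m1 * m2 / (m1 + m2)" and "\<nu> = m3 * (m1 + m2) / (m1 + m2 + m3)"
  have \<mu>: "\<mu> > 0" "\<nu> > 0" using m by (auto simp: \<mu>_def \<nu>_def)
  \<comment> \<open>The kinetic energy controls both momenta, and \<open>d12\<close> and
    \<open>d13\<close> control \<open>q\<close> and \<open>Q\<close>.\<close>
  have bound: "norm t \<le> B + sqrt (2 * \<mu> * B) + 2 * B + sqrt (2 * \<nu> * B)"
    if t: "t \<in> level_set m1 m2 m3 L" "energy m1 m2 m3 t \<le> e" for t
  proof -
    obtain q p Q P where tq: "t = (q, p, Q, P)" by (cases t)
    let ?b = "m2 / (m1 + m2)"
    have *: "kinetic m1 m2 m3 t \<le> B" "norm q \<le> B" "norm (Q + ?b *\<^sub>R q) \<le> B"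
      using B[OF configuration_of_level_set[OF m]] t energy_eq[OF m] unfolding tq by auto
    have T: "(norm p)\<^sup>2 / (2 * \<mu>) + (norm P)\<^sup>2 / (2 * \<nu>) = kinetic m1 m2 m3 t"
      by (simp add: tq kinetic_def \<mu>_def \<nu>_def)
    have "(norm p)\<^sup>2 / (2 * \<mu>) \<ge> 0" "(norm P)\<^sup>2 / (2 * \<nu>) \<ge> 0"
      using \<mu> by auto
    with T *(1) have "(norm p)\<^sup>2 / (2 * \<mu>) \<le> B" "(norm P)\<^sup>2 / (2 * \<nu>) \<le> B"
      by linarith+
    then have "(norm p)\<^sup>2 \<le> 2 * \<mu> * B" "(norm P)\<^sup>2 \<le> 2 * \<nu> * B"
      using \<mu> by (simp_all add: pos_divide_le_eq mult_ac)
    then have pP: "norm p \<le> sqrt (2 * \<mu> * B)" "norm P \<le> sqrt (2 * \<nu> * B)"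
      by (simp_all add: real_le_rsqrt)
    have "?b * norm q \<le> norm q"
      using m by (intro mult_left_le_one_le) auto
    then have "norm (?b *\<^sub>R q) \<le> B"
      using *(2) m by simp
    then have "norm Q \<le> 2 * B"
      using *(3) norm_diff_ineq[of Q "?b *\<^sub>R q"] by linarith
    moreover have "norm t \<le> norm q + (norm p + (norm Q + norm P))"
      unfolding tq by (intro order.trans[OF norm_Pair_le] add_left_mono order.refl)
    ultimately show ?thesis
      using pP *(2) by linarith
  qed
  have "\<forall>\<^sub>F n in sequentially. ereal (energy m1 m2 m3 (s n)) < ereal e"
    using assms(7) e(1) by (rule order_tendstoD)
  then have "\<forall>\<^sub>F n in sequentially. norm (s n) \<le> B + sqrt (2 * \<mu> * B) + 2 * B + sqrt (2 * \<nu> * B)"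
    by eventually_elim (use assms(6) bound in auto)
  \<comment> \<open>An eventual bound suffices, since only finitely many states are left
    out.\<close>
  then show ?thesis
    unfolding Bseq_eq_bounded[symmetric] by (rule BfunI)
qed

end
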